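(* There exist $\varepsilon_0>0$ and $n_0$ such that for every integer $n\ge n_0$ divisible by $4$ the following holds. If $G$ is a $3$-graph of order $n$ satisfying $$ \delta_2(G)\ge \begin{cases} \frac{n}{4} & \text{when } \frac{n}{4} \text{ is odd,}\\[2pt] \frac{n}{4}+1 & \text{when } \frac{n}{4} \text{ is even,} \end{cases} $$ and $G$ is $\varepsilon_0$-extremal, then $G$ is $D$-tileable.
   Context: A $3$-graph is a $3$-uniform hypergraph $G$ with finite vertex set $V(G)$ and edge set $E(G) \subseteq \binom{V(G)}{3}$; its order is $|V(G)|$. $D=K_4^3-2e$ denotes the $3$-graph on $4$ vertices with exactly $2$ edges. For a pair $\{u,v\}$ of vertices, $N(u,v)=\{w: \{u,v,w\}\in E(G)\}$, and $\delta_2(G)=\min\{|N(u,v)| : \{u,v\}\in\binom{V(G)}{2}\}$. A $3$-graph of order $n$ is $D$-tileable if it contains, as (not necessarily induced) subhypergraphs, $\lfloor n/4\rfloor$ vertex-disjoint copies of $D$. For $S\subset V(G)$, $G[S]$ is the subhypergraph induced on $S$; a $3$-graph is $D$-free if it contains no copy of $D$ as a (not necessarily induced) subhypergraph. For $\varepsilon>0$, a $3$-graph $G$ of order $n$ is $\varepsilon$-extremal if there exists $S\subset V(G)$ of size $|S|\ge(1-\varepsilon)\frac{3n}{4}$ for which $G[S]$ is $D$-free. *)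

theory Defs
  imports Complex_Main "HOL-Library.Ramsey"
begin

type_synonym 'a hypergraph = "'a set \<times> 'a set set"

definition hverts :: "'a hypergraph \<Rightarrow> 'a set" where
  "hverts G = fst G"

definition hedges :: "'a hypergraph \<Rightarrow> 'a set set" where
  "hedges G = snd G"

definition three_graph :: "'a hypergraph \<Rightarrow> bool" where
  "three_graph G \<longleftrightarrow> finite (hverts G) \<and> hedges G \<subseteq> nsets (hverts G) 3"

definition order_of :: "'a hypergraph \<Rightarrow> nat" where
  "order_of G = card (hverts G)"

definition subhypergraph :: "'a hypergraph \<Rightarrow> 'a hypergraph \<Rightarrow> bool" where
  "subhypergraph H G \<longleftrightarrow> hverts H \<subseteq> hverts G \<and> hedges H \<subseteq> hedges G"

definition induced :: "'a hypergraph \<Rightarrow> 'a set \<Rightarrow> 'a hypergraph" where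
  "induced G S = (S, {e \<in> hedges G. e \<subseteq> S})"

definition nbhd :: "'a hypergraph \<Rightarrow> 'a \<Rightarrow> 'a \<Rightarrow> 'a set" where
  "nbhd G u v = {w. {u, v, w} \<in> hedges G}"

(* Meaningful only for order at least 2: otherwise this is the unspecified Min {}.
   Membership of {u, v} in nsets _ 2 forces u and v to be distinct. *)
definition min_codegree :: "'a hypergraph \<Rightarrow> nat" where
  "min_codegree G = Min {card (nbhd G u v) | u v. {u, v} \<in> nsets (hverts G) 2}"

(* Up to isomorphism there is exactly one 3-graph with 4 vertices and 2 edges,
   so this says that H is isomorphic to D. *)
definition is_D :: "'a hypergraph \<Rightarrow> bool" where
  "is_D H \<longleftrightarrow> three_graph H \<and> card (hverts H) = 4 \<and> card (hedges H) = 2"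

definition D_copy_in :: "'a hypergraph \<Rightarrow> 'a hypergraph \<Rightarrow> bool" where
  "D_copy_in H G \<longleftrightarrow> is_D H \<and> subhypergraph H G"

definition D_free :: "'a hypergraph \<Rightarrow> bool" where
  "D_free G \<longleftrightarrow> \<not> (\<exists>H. D_copy_in H G)"

definition D_tileable :: "'a hypergraph \<Rightarrow> bool" where
  "D_tileable G \<longleftrightarrow>
     (\<exists>T. finite T \<and> card T = order_of G div 4 \<and> (\<forall>H\<in>T. D_copy_in H G) \<and>
          pairwise (\<lambda>H K. hverts H \<inter> hverts K = {}) T)"

definition extremal :: "real \<Rightarrow> 'a hypergraph \<Rightarrow> bool" where
  "extremal \<epsilon> G \<longleftrightarrow>
     (\<exists>S \<subseteq> hverts G. real (card S) \<ge> (1 - \<epsilon>) * (3 * real (order_of G) / 4) \<and>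
        D_free (induced G S))"

end

theory Submission
  imports Defs
begin

text \<open>
  Write $n = 4m$ and enlarge the given set to a \<^emph>\<open>maximal\<close> $D$-free set $S$; let $A$ be its
  complement. Two edges inside $S$ never share a pair, so a pair of vertices of $S$ has at most one
  neighbour in $S$ and at least $m - 1$ neighbours in $A$. As $|A|$ is at most slightly larger than
  $m$, nearly all triples with one vertex in $A$ and two in $S$ are edges.

  Parity enters only to show $|A| \<ge> m$. If $|A| < m$, then the codegree condition forces $|A| = m - 1$,
  $m$ to be odd and every pair of vertices of $S$ to have exactly one neighbour in $S$; thus $S$ carries a
  Steiner triple system on $3m + 1$ points, an even number, which is impossible
  (\<open>odd_card_if_unique_third_vertex\<close>).

  So let $|A| = m + k$ and $|S| = 3m - k$ with $k$ a tiny fraction of $m$. A perfect tiling is obtained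
  from $k$ tiles with two vertices in $A$ and two in $S$ together with tiles that have one vertex in $A$ and
  three in $S$; these numbers balance exactly. The obstacle is the set of \<^emph>\<open>sparse\<close> vertices of $A$, those
  whose link contains only few pairs of $S$. By the codegree condition, a sparse vertex $a$ has, together
  with most $s \<in> S$, well over half of $A$ as common neighbours, so it fits into a tile of the type two plus two
  (\<open>sparse_tile_2\<close>). This handles $k$ sparse vertices. If there are $k + j$ of them, then $j$ are put
  into tiles of the type one plus three. Every pair of $S$ misses at most $k + 1$ vertices of $A$, so for
  $j \<ge> 2$ the links of the sparse vertices still contain many pairs in total, and $j$ disjoint
  tiles can be chosen greedily; for $j = 1$ one tile is enough, and it exists because $S$ is maximal
  (\<open>sparse_1_packing\<close>).

  What remains is a balanced part without sparse vertices (\<open>packing_of_balanced_part\<close>). Cut its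
  share of $S$ into triples. Each triple forms a tile with all but few vertices of $A$, so by double
  counting all but few vertices $a$ form tiles with most of the triples. The exceptional ones are tiled
  greedily, the few damaged triples are recombined, and a bijection between the remaining vertices and
  the triples is found by the exchange argument of \<open>swap_bijection\<close>.
\<close>

section \<open>Finite combinatorics\<close>

lemma distinct_if_card_3: "card {x, y, z} = 3 \<Longrightarrow> x \<noteq> y \<and> x \<noteq> z \<and> y \<noteq> z"
  by (auto simp: card_insert_if split: if_splits)

lemma pairwise_disjnt_Un:
  assumes F: "pairwise disjnt F" and G: "pairwise disjnt G" and FG: "\<Union>F \<inter> \<Union>G = {}"
  shows "pairwise disjnt (F \<union> G)"
proof -
  have "disjnt X Y \<and> disjnt Y X" if "X \<in> F" "Y \<in> G" for X Y
    using that FG unfolding disjnt_def by blast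
  then show ?thesis
    using F G unfolding pairwise_def by blast
qed

lemma families_disjoint:
  assumes "{} \<notin> F" "\<Union>F \<inter> \<Union>G = {}"
  shows "F \<inter> G = {}"
proof (rule equals0I)
  fix Y assume Y: "Y \<in> F \<inter> G"
  then have "Y \<subseteq> \<Union>F \<inter> \<Union>G" by auto
  then show False using assms Y by simp
qed

text \<open>
  A bijection with the most compatible pairs is compatible everywhere: the value of an incompatible $a$
  could be exchanged with that of some $b$ so that both become compatible, because $a$ and its value
  together exclude at most $x + y$ candidates for $b$.
\<close>

lemma swap_bijection:
  fixes R :: "'a \<Rightarrow> 'b \<Rightarrow> bool"
  assumes fin: "finite A" "finite P" and card_eq: "card A = card P"
    and x: "\<And>a. a \<in> A \<Longrightarrow> card {T \<in> P. \<not> R a T} \<le> x"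
    and y: "\<And>T. T \<in> P \<Longrightarrow> card {a \<in> A. \<not> R a T} \<le> y"
    and less: "x + y < card A"
  shows "\<exists>f. bij_betw f A P \<and> (\<forall>a\<in>A. R a (f a))"
proof -
  define good where "good f = {a \<in> A. R a (f a)}" for f :: "'a \<Rightarrow> 'b"
  obtain f0 where f0: "bij_betw f0 A P"
    using fin card_eq finite_same_card_bij by blast
  have "\<exists>f. bij_betw f A P \<and> (\<forall>g. bij_betw g A P \<longrightarrow> card (good g) \<le> card (good f))"
    by (rule ex_has_greatest_nat[where P = "\<lambda>f. bij_betw f A P" and f = "\<lambda>f. card (good f)"
          and b = "Suc (card A)" and k = f0])
      (auto simp: f0 good_def fin less_Suc_eq_le intro: card_mono)
  then obtain f where f: "bij_betw f A P"
    and max: "\<And>g. bij_betw g A P \<Longrightarrow> card (good g) \<le> card (good f)" by blast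
  have "R a (f a)" if a: "a \<in> A" for a
  proof (rule ccontr)
    assume nR: "\<not> R a (f a)"
    have fa: "f a \<in> P" using f a by (auto dest: bij_betwE)
    have "card {b \<in> A. \<not> R a (f b)} = card (f ` {b \<in> A. \<not> R a (f b)})"
      using f by (intro card_image[symmetric]) (auto simp: bij_betw_def inj_on_def)
    also have "\<dots> \<le> card {T \<in> P. \<not> R a T}"
      using f fin by (intro card_mono) (auto dest: bij_betwE)
    finally have 1: "card {b \<in> A. \<not> R a (f b)} \<le> x" using x[OF a] by linarith
    have "card ({b \<in> A. \<not> R a (f b)} \<union> {b \<in> A. \<not> R b (f a)}) < card A"
      using card_Un_le[of "{b \<in> A. \<not> R a (f b)}" "{b \<in> A. \<not> R b (f a)}"] 1 y[OF fa] less
      by linarith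
    then have "{b \<in> A. \<not> R a (f b)} \<union> {b \<in> A. \<not> R b (f a)} \<noteq> A" by auto
    then obtain b where b: "b \<in> A" "R a (f b)" "R b (f a)" by blast
    have ab: "a \<noteq> b" using b nR by auto
    define g where "g = f(a := f b, b := f a)"
    have "inj_on g A"
      using f a b(1) by (auto simp: g_def bij_betw_def inj_on_def)
    moreover have "g ` A \<subseteq> P"
      using f a b(1) by (auto simp: g_def dest: bij_betwE)
    ultimately have g: "bij_betw g A P"
      using fin card_eq by (simp add: bij_betw_def card_image card_subset_eq)
    have "insert a (good f) \<subseteq> good g"
      using a b ab by (auto simp: good_def g_def)
    moreover have "finite (good g)" "finite (good f)" using fin by (auto simp: good_def)
    moreover have "a \<notin> good f" using nR by (simp add: good_def)
    ultimately have "card (good f) < card (good g)"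
      by (metis card_insert_disjoint card_mono Suc_le_lessD)
    with max[OF g] show False by simp
  qed
  with f show ?thesis by blast
qed

text \<open>
  Starting from a given $P$ allows the recombination step: the triples that are still intact are kept,
  and only the vertices left over are grouped afresh.
\<close>

lemma extend_to_triple_partition:
  assumes "finite R" "card R = 3 * n" "P \<subseteq> Pow R" "pairwise disjnt P" "\<And>T. T \<in> P \<Longrightarrow> card T = 3"
  shows "\<exists>P'. P \<subseteq> P' \<and> P' \<subseteq> Pow R \<and> pairwise disjnt P' \<and> (\<forall>T\<in>P'. card T = 3) \<and> card P' = n"
  using assms
proof (induction "n - card P" arbitrary: P)
  case 0
  have fT: "finite T" if "T \<in> P" for T using 0(2,4) that by (meson PowD finite_subset subsetD)
  have "card (\<Union>P) = 3 * card P"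
    using 0(5,6) fT by (subst card_Union_disjoint) auto
  moreover have "card (\<Union>P) \<le> 3 * n" using 0(2,3,4) by (metis card_mono Union_Pow_eq Union_mono)
  ultimately have "card P = n" using 0(1) by simp
  then show ?case using 0 by blast
next
  case (Suc d)
  have finP: "finite P" using Suc.prems by (meson finite_Pow_iff finite_subset)
  have fT: "finite T" if "T \<in> P" for T using Suc.prems that by (meson PowD finite_subset subsetD)
  have "card (\<Union>P) = 3 * card P"
    using Suc.prems fT by (subst card_Union_disjoint) auto
  moreover have sub: "\<Union>P \<subseteq> R" using Suc.prems by auto
  ultimately have "3 \<le> card (R - \<Union>P)"
    using Suc.hyps(2) Suc.prems by (subst card_Diff_subset) (auto intro: finite_subset)
  then obtain T where T: "T \<subseteq> R - \<Union>P" "card T = 3" by (meson obtain_subset_with_card_n)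
  have "T \<noteq> {}" using T by auto
  then have "T \<notin> P" using T by blast
  then have d: "d = n - card (insert T P)" using Suc.hyps(2) finP by simp
  have "\<exists>P'. insert T P \<subseteq> P' \<and> P' \<subseteq> Pow R \<and> pairwise disjnt P' \<and> (\<forall>T\<in>P'. card T = 3) \<and> card P' = n"
  proof (rule Suc.hyps(1)[OF d])
    have "disjnt T X \<and> disjnt X T" if "X \<in> P" for X
      using T(1) that by (auto simp: disjnt_iff)
    then show "pairwise disjnt (insert T P)"
      using Suc.prems(4) by (simp add: pairwise_insert)
  qed (use Suc.prems T in auto)
  then show ?case by (rule ex_forward) simp
qed

text \<open>
  Each element of $I$ picks its own $c$-set outside what is used already; the forbidden set handed to
  \<open>pick\<close> also contains the elements of $I$ still to come, so that none of them is swallowed early.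
\<close>

lemma greedy_disjoint_cover:
  assumes "finite I" "finite U" "I \<inter> U = {}"
    and pick: "\<And>i U. i \<in> I \<Longrightarrow> finite U \<Longrightarrow> card U \<le> N \<Longrightarrow> i \<notin> U \<Longrightarrow> \<exists>X. Q X \<and> i \<in> X \<and> X \<inter> U = {}"
    and Q: "\<And>X. Q X \<Longrightarrow> card X = c" and c: "0 < c"
    and N: "c * card I + card U \<le> N"
  shows "\<exists>F. finite F \<and> card F = card I \<and> (\<forall>X\<in>F. Q X) \<and> pairwise disjnt F \<and> \<Union>F \<inter> U = {} \<and> I \<subseteq> \<Union>F"
  using assms(1,2,3) pick N
proof (induction I arbitrary: U rule: finite_induct)
  case empty
  then show ?case by (intro exI[of _ "{}"]) auto
next
  case (insert i I)
  have "card (insert i U) \<le> Suc (card U)" by (simp add: card_insert_le_m1 insert.prems)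
  then have "c * card I + card (insert i U) \<le> N"
    using insert.prems(4) insert.hyps c by simp
  moreover have "I \<inter> insert i U = {}" using insert by auto
  \<comment> \<open>The element treated last is forbidden for all the others.\<close>
  ultimately obtain F where F: "finite F" "card F = card I" "\<forall>X\<in>F. Q X" "pairwise disjnt F"
    "\<Union>F \<inter> insert i U = {}" "I \<subseteq> \<Union>F"
    using insert.IH[of "insert i U"] insert.prems by (metis finite_insert insertCI)
  have fin: "finite X" if "X \<in> F" for X using F(3) Q c that by (metis card.infinite less_irrefl)
  have "card (\<Union>F) = c * card I"
    using F fin Q by (subst card_Union_disjoint) auto
  then have "card (U \<union> \<Union>F) \<le> N"
    using card_Un_le[of U "\<Union>F"] insert.prems(4) insert.hyps by simp
  then obtain X where X: "Q X" "i \<in> X" "X \<inter> (U \<union> \<Union>F) = {}"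
    using insert.prems(3)[of i "U \<union> \<Union>F"] F fin insert.prems(1,2) by auto
  have "X \<notin> F" using X by blast
  moreover have "pairwise disjnt (insert X F)"
    using F(4) X(3) unfolding pairwise_def disjnt_def by blast
  ultimately show ?case
    using F X insert.hyps insert.prems by (intro exI[of _ "insert X F"]) auto
qed

section \<open>Tiles and packings\<close>

definition spans_D :: "'a set set \<Rightarrow> 'a set \<Rightarrow> bool" where
  "spans_D E X \<longleftrightarrow> (\<exists>e\<in>E. \<exists>f\<in>E. e \<noteq> f \<and> e \<subseteq> X \<and> f \<subseteq> X)"

lemma spans_DI: "e \<in> E \<Longrightarrow> f \<in> E \<Longrightarrow> e \<noteq> f \<Longrightarrow> e \<subseteq> X \<Longrightarrow> f \<subseteq> X \<Longrightarrow> spans_D E X"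
  unfolding spans_D_def by blast

text \<open>
  The situation after the choice of $S$, with $E$ the edge set on $A \<union> S$. The assumption
  \<open>saturated\<close> is what remains of the maximality of $S$, and \<open>pair_in_S\<close> of its $D$-freeness.
  The constant 10000 leaves room for forbidden sets of up to $200(k + 1)$ vertices in all greedy
  choices, even when a link contains only one pair of $S$ in forty.
\<close>

locale near_extremal =
  fixes E :: "'a set set" and A S :: "'a set" and m k :: nat
  assumes finA: "finite A" and finS: "finite S" and disj: "A \<inter> S = {}"
    and cardA: "card A = m + k" and cardS: "card S + k = 3 * m"
    and large: "10000 * (k + 1) \<le> m"
    and edge_card: "\<And>e. e \<in> E \<Longrightarrow> card e = 3"
    and pair_in_S: "\<And>s t. s \<in> S \<Longrightarrow> t \<in> S \<Longrightarrow> s \<noteq> t \<Longrightarrow> m \<le> card {a \<in> A. {a, s, t} \<in> E} + 1"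
    and pair_across: "\<And>a s. a \<in> A \<Longrightarrow> s \<in> S \<Longrightarrow> m \<le> card {w \<in> A \<union> S. {a, s, w} \<in> E}"
    and saturated: "\<And>a. a \<in> A \<Longrightarrow> \<exists>T \<subseteq> S. card T = 3 \<and> spans_D E (insert a T)"
begin

definition mixed_tile :: "nat \<Rightarrow> 'a set \<Rightarrow> bool" where
  "mixed_tile i X \<longleftrightarrow> X \<subseteq> A \<union> S \<and> card (X \<inter> A) = i \<and> card (X \<inter> S) = 4 - i \<and> spans_D E X"

definition packing :: "nat \<Rightarrow> 'a set set \<Rightarrow> bool" where
  "packing i F \<longleftrightarrow> finite F \<and> pairwise disjnt F \<and> (\<forall>X\<in>F. mixed_tile i X)"

text \<open>
  Counts ordered pairs, hence twice the number of edges that join $a$ to two vertices of $S$; its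
  largest possible value is $|S|(|S| - 1)$.
\<close>

definition link_size :: "'a \<Rightarrow> nat" where
  "link_size a = card {(s, t) \<in> S \<times> S. {a, s, t} \<in> E}"

definition sparse :: "'a set" where
  "sparse = {a \<in> A. 40 * link_size a < card S * card S}"

text \<open>
  The largest number of vertices of $A$ that a pair of vertices of $S$ can miss; see
  \<open>card_missing\<close>. All error terms below are small multiples of this number.
\<close>

definition K :: nat where
  "K = k + 1"

lemma sizes:
  shows "K = k + 1" "10000 * K \<le> m" "20000 * K \<le> card S" "card S \<le> 3 * m" "2 * m \<le> card S"
proof -
  show K: "K = k + 1" "10000 * K \<le> m" using large by (auto simp: K_def)
  show "20000 * K \<le> card S" using cardS K by linarith
  show "card S \<le> 3 * m" using cardS by linarith
  show "2 * m \<le> card S" using cardS K by linarith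
qed

lemma edge_distinct: "{a, s, t} \<in> E \<Longrightarrow> a \<noteq> s \<and> a \<noteq> t \<and> s \<noteq> t"
  using distinct_if_card_3 edge_card by metis

lemma card_mixed_tile:
  assumes "mixed_tile i X" "i \<le> 4"
  shows "card X = 4" "finite X"
proof -
  have X: "X = (X \<inter> A) \<union> (X \<inter> S)" using assms by (auto simp: mixed_tile_def)
  have "card ((X \<inter> A) \<union> (X \<inter> S)) = card (X \<inter> A) + card (X \<inter> S)"
    by (rule card_Un_disjoint) (use finA finS disj in auto)
  then show "card X = 4" using assms X by (simp add: mixed_tile_def)
  show "finite X" using X finA finS by (metis finite_Int finite_Un)
qed

lemma card_packing:
  assumes "packing i F"
  shows "card (\<Union>F \<inter> A) = i * card F" "card (\<Union>F \<inter> S) = (4 - i) * card F"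
proof -
  have *: "card (\<Union>F \<inter> Y) = (\<Sum>X\<in>F. card (X \<inter> Y))" if "finite Y" for Y
  proof -
    have "\<Union>F \<inter> Y = (\<Union>X\<in>F. X \<inter> Y)" by auto
    also have "card \<dots> = (\<Sum>X\<in>F. card (X \<inter> Y))"
      using assms that by (intro card_UN_disjoint) (auto simp: packing_def pairwise_def disjnt_def)
    finally show ?thesis .
  qed
  show "card (\<Union>F \<inter> A) = i * card F" "card (\<Union>F \<inter> S) = (4 - i) * card F"
    using *[OF finA] *[OF finS] assms by (auto simp: packing_def mixed_tile_def)
qed

lemma packing_insert:
  assumes "packing i F" "mixed_tile i X" "X \<inter> \<Union>F = {}" "i \<le> 4"
  shows "packing i (insert X F)" "card (insert X F) = Suc (card F)"
proof -
  have "X \<noteq> {}" using card_mixed_tile[OF assms(2,4)] by auto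
  then have "X \<notin> F" using assms(3) by blast
  moreover have "pairwise disjnt (insert X F)"
    using assms unfolding packing_def pairwise_def disjnt_def by blast
  ultimately show "packing i (insert X F)" "card (insert X F) = Suc (card F)"
    using assms by (auto simp: packing_def)
qed

lemma mixed_tile_1I:
  assumes "a \<in> A" "T \<subseteq> S" "card T = 3" "spans_D E (insert a T)"
  shows "mixed_tile 1 (insert a T)"
proof -
  have "T \<inter> A = {}" "T \<inter> S = T" "a \<notin> S" using assms disj by auto
  then show ?thesis using assms unfolding mixed_tile_def by auto
qed

lemma mixed_tile_2I:
  assumes "a \<in> A" "b \<in> A" "a \<noteq> b" "s \<in> S" "t \<in> S" "s \<noteq> t" "spans_D E {a, b, s, t}"
  shows "mixed_tile 2 {a, b, s, t}"
proof -
  have "{a, b, s, t} \<inter> A = {a, b}" "{a, b, s, t} \<inter> S = {s, t}" using assms disj by auto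
  then show ?thesis using assms unfolding mixed_tile_def by auto
qed

section \<open>Links and tiles through a given vertex\<close>

lemma card_missing:
  assumes "s \<in> S" "t \<in> S" "s \<noteq> t"
  shows "card {a \<in> A. {a, s, t} \<notin> E} \<le> K"
proof -
  have "{a \<in> A. {a, s, t} \<notin> E} = A - {a \<in> A. {a, s, t} \<in> E}" by auto
  then have "card {a \<in> A. {a, s, t} \<notin> E} = card A - card {a \<in> A. {a, s, t} \<in> E}"
    using finA by (simp add: card_Diff_subset)
  then show ?thesis using pair_in_S[OF assms] cardA sizes by linarith
qed

text \<open>
  Double counting of the non-edges with one vertex in $B$ and two in $S$: each of the $|S|(|S| - 1)$
  ordered pairs is missed by at most $K$ vertices of $B$.
\<close>

lemma sum_link_size:
  assumes "B \<subseteq> A"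
  shows "card B * (card S * (card S - 1)) \<le> (\<Sum>a\<in>B. link_size a) + K * (card S * (card S - 1))"
proof -
  have finB: "finite B" using assms finA finite_subset by blast
  define Q where "Q = {(s, t) \<in> S \<times> S. s \<noteq> t}"
  have Q: "Q = S \<times> S - (\<lambda>s. (s, s)) ` S" by (auto simp: Q_def)
  have finQ: "finite Q" by (simp add: Q finS)
  have "card ((\<lambda>s. (s, s)) ` S) = card S" by (intro card_image) (auto simp: inj_on_def)
  then have "card Q = card S * card S - card S"
    unfolding Q using finS by (subst card_Diff_subset) (auto simp: card_cartesian_product)
  then have cardQ: "card Q = card S * (card S - 1)" by (simp add: diff_mult_distrib2)
  have "card B * card Q = (\<Sum>a\<in>B. link_size a + card {q \<in> Q. {a, fst q, snd q} \<notin> E})"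
  proof -
    have "card Q = link_size a + card {q \<in> Q. {a, fst q, snd q} \<notin> E}" if "a \<in> B" for a
    proof -
      have "{(s, t) \<in> S \<times> S. {a, s, t} \<in> E} = {q \<in> Q. {a, fst q, snd q} \<in> E}"
        using edge_distinct by (auto simp: Q_def)
      then have "link_size a = card {q \<in> Q. {a, fst q, snd q} \<in> E}" by (simp add: link_size_def)
      moreover have "Q = {q \<in> Q. {a, fst q, snd q} \<in> E} \<union> {q \<in> Q. {a, fst q, snd q} \<notin> E}" by auto
      then have "card Q = card {q \<in> Q. {a, fst q, snd q} \<in> E} + card {q \<in> Q. {a, fst q, snd q} \<notin> E}"
        using finQ by (subst card_Un_disjoint[symmetric]) auto
      ultimately show ?thesis by simp
    qed
    then show ?thesis by (metis (no_types, lifting) sum.cong sum_constant of_nat_id)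
  qed
  also have "\<dots> = (\<Sum>a\<in>B. link_size a) + (\<Sum>a\<in>B. card {q \<in> Q. {a, fst q, snd q} \<notin> E})"
    by (simp add: sum.distrib)
  also have "(\<Sum>a\<in>B. card {q \<in> Q. {a, fst q, snd q} \<notin> E}) = (\<Sum>q\<in>Q. card {a \<in> B. {a, fst q, snd q} \<notin> E})"
    using finB finQ by (intro sum_multicount_gen) auto
  also have "\<dots> \<le> (\<Sum>q\<in>Q. K)"
  proof (rule sum_mono)
    fix q assume "q \<in> Q"
    then have "card {a \<in> A. {a, fst q, snd q} \<notin> E} \<le> K"
      by (intro card_missing) (auto simp: Q_def)
    moreover have "card {a \<in> B. {a, fst q, snd q} \<notin> E} \<le> card {a \<in> A. {a, fst q, snd q} \<notin> E}"
      using assms finA by (intro card_mono) auto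
    ultimately show "card {a \<in> B. {a, fst q, snd q} \<notin> E} \<le> K" by linarith
  qed
  finally show ?thesis by (simp add: cardQ mult.commute)
qed

lemma sparse_subset: "sparse \<subseteq> A" and finite_sparse: "finite sparse"
  using finA by (auto simp: sparse_def)

text \<open>
  More than $2K$ sparse vertices would miss too many pairs for \<open>sum_link_size\<close>, as each misses nearly
  all of them.
\<close>

lemma card_sparse: "card sparse \<le> 2 * K"
proof (rule ccontr)
  assume "\<not> ?thesis"
  then have b: "2 * K < card sparse" by simp
  have "(\<Sum>a\<in>sparse. 40 * link_size a) \<le> (\<Sum>a\<in>sparse. card S * card S)"
    by (rule sum_mono) (auto simp: sparse_def)
  then have p: "40 * (\<Sum>a\<in>sparse. link_size a) \<le> card sparse * (card S * card S)"
    by (simp add: sum_distrib_left)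
  obtain M where M: "card S = Suc M" using sizes by (cases "card S") auto
  have "40 * (card sparse * (Suc M * M)) \<le> card sparse * (Suc M * Suc M) + 40 * (K * (Suc M * M))"
    using sum_link_size[OF sparse_subset] p M by simp
  then have "Suc M * (40 * (card sparse * M)) \<le> Suc M * (card sparse * Suc M + 40 * (K * M))"
    by (simp only: distrib_left mult.left_commute mult.commute mult.assoc)
  then have "40 * (card sparse * M) \<le> card sparse * Suc M + 40 * (K * M)"
    by (simp only: Suc_mult_le_cancel1)
  moreover have "card sparse * Suc M \<le> card sparse * (2 * M)"
    using sizes M by (intro mult_left_mono) auto
  moreover have "2 * (K * M) \<le> card sparse * M"
    using b mult_le_mono1[of "2 * K" "card sparse" M] by (simp only: mult.assoc)
  moreover have "0 < card sparse * M" using b sizes M by auto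
  ultimately show False by linarith
qed

text \<open>
  Two pairs of the link of $a$ with a common vertex give a tile. If there were none outside $W$, the link
  would be a matching there, and all other pairs of the link would meet $W$.
\<close>

lemma cherry_of_large_link:
  assumes a: "a \<in> A" and W: "finite W" and many: "(2 * card W + 1) * card S < link_size a"
  shows "\<exists>T \<subseteq> S - W. card T = 3 \<and> spans_D E (insert a T)"
proof (rule ccontr)
  assume none: "\<not> ?thesis"
  define L where "L = {(s, t) \<in> (S - W) \<times> (S - W). {a, s, t} \<in> E}"
  have unique: "t = u" if "(s, t) \<in> L" "(s, u) \<in> L" for s t u
  proof (rule ccontr)
    assume tu: "t \<noteq> u"
    have stu: "s \<in> S - W" "t \<in> S - W" "u \<in> S - W" and E: "{a, s, t} \<in> E" "{a, s, u} \<in> E"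
      using that by (auto simp: L_def)
    have d: "s \<noteq> t" "s \<noteq> u" "a \<noteq> u" using edge_distinct E by blast+
    then have "u \<notin> {a, s, t}" using tu by simp
    then have "{a, s, t} \<noteq> {a, s, u}" by blast
    then have "spans_D E (insert a {s, t, u})"
      by (rule spans_DI[OF E]) auto
    moreover have "card {s, t, u} = 3" "{s, t, u} \<subseteq> S - W" using d tu stu by auto
    ultimately show False using none by blast
  qed
  have "inj_on fst L"
    by (auto intro!: inj_onI dest: unique)
  then have "card L \<le> card S"
    using finS by (intro card_inj_on_le[of fst L S]) (auto simp: L_def)
  have "{(s, t) \<in> S \<times> S. {a, s, t} \<in> E} \<subseteq> (W \<times> S \<union> S \<times> W) \<union> L"
    by (auto simp: L_def)
  moreover have "finite L" using finS by (auto simp: L_def intro: finite_subset[of _ "S \<times> S"])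
  ultimately have "link_size a \<le> card ((W \<times> S \<union> S \<times> W) \<union> L)"
    unfolding link_size_def using finS W by (intro card_mono) auto
  also have "\<dots> \<le> card (W \<times> S) + card (S \<times> W) + card L"
    by (meson add_le_mono1 card_Un_le le_trans)
  also have "\<dots> \<le> (2 * card W + 1) * card S"
    using \<open>card L \<le> card S\<close> by (simp add: card_cartesian_product)
  finally show False using many by simp
qed

lemma dense_tile_1:
  assumes a: "a \<in> A - sparse" and U: "finite U" "card U \<le> 200 * K" "a \<notin> U"
  shows "\<exists>X. mixed_tile 1 X \<and> a \<in> X \<and> X \<inter> U = {}"
proof -
  have p: "card S * card S \<le> 40 * link_size a" using a by (auto simp: sparse_def)
  have "80 * card U + 40 < card S" using U sizes by linarith
  then have "40 * (2 * card U + 1) < card S" by simp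
  then have "40 * (2 * card U + 1) * card S < card S * card S"
    using sizes by (intro mult_strict_right_mono) auto
  then have "40 * ((2 * card U + 1) * card S) < card S * card S" by (simp only: mult.assoc)
  then have "(2 * card U + 1) * card S < link_size a"
    using p by linarith
  then obtain T where "T \<subseteq> S - U" "card T = 3" "spans_D E (insert a T)"
    using cherry_of_large_link a U by blast
  then show ?thesis
    using mixed_tile_1I[of a T] a U by (intro exI[of _ "insert a T"]) auto
qed

text \<open>
  By averaging, most $s \<in> S$ have few neighbours in $S$ together with $a$, so that $a$ and $s$ have
  at least $7m/10$ of the about $m$ vertices of $A$ as common neighbours. Any two such vertices $s$ and $t$ therefore
  share a neighbour $b$, and the edges $asb$ and $atb$ form a tile.
\<close>

lemma sparse_tile_2:
  assumes a: "a \<in> sparse" and U: "finite U" "card U \<le> 200 * K" "a \<notin> U"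
  shows "\<exists>X. mixed_tile 2 X \<and> a \<in> X \<and> X \<inter> U = {}"
proof -
  have aA: "a \<in> A" using a by (auto simp: sparse_def)
  define deg where "deg s = card {t \<in> S. {a, s, t} \<in> E}" for s
  have "{(s, t) \<in> S \<times> S. {a, s, t} \<in> E} = (SIGMA s:S. {t \<in> S. {a, s, t} \<in> E})" by auto
  then have p: "link_size a = (\<Sum>s\<in>S. deg s)"
    using finS by (simp add: link_size_def deg_def)
  \<comment> \<open>The exceptional vertices; there are fewer than a quarter of all.\<close>
  define H where "H = {s \<in> S. card S < 10 * deg s}"
  have "card H * card S = (\<Sum>s\<in>H. card S)" by simp
  also have "\<dots> \<le> (\<Sum>s\<in>H. 10 * deg s)" by (rule sum_mono) (auto simp: H_def)
  also have "\<dots> \<le> (\<Sum>s\<in>S. 10 * deg s)" using finS by (intro sum_mono2) (auto simp: H_def)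
  finally have "card H * card S \<le> 10 * link_size a"
    by (simp add: p sum_distrib_left)
  moreover have "40 * link_size a < card S * card S" using a by (simp add: sparse_def)
  ultimately have "4 * (card H * card S) < card S * card S" by linarith
  then have "(4 * card H) * card S < card S * card S" by (simp only: mult.assoc)
  then have "4 * card H < card S" by (simp only: mult_less_cancel2)
  moreover have "card (H \<union> U) \<le> card H + card U" by (rule card_Un_le)
  ultimately have "card (H \<union> U) + 2 \<le> card S" using U sizes by linarith
  then have "2 \<le> card (S - (H \<union> U))" using diff_card_le_card_Diff[of "H \<union> U" S] finS U 
    by (simp add: H_def)
  then obtain st where "st \<subseteq> S - (H \<union> U)" "card st = 2" by (meson obtain_subset_with_card_n)
  then obtain s t where st: "s \<in> S" "t \<in> S" "s \<noteq> t" "s \<notin> U" "t \<notin> U" "s \<notin> H" "t \<notin> H"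
    by (auto simp: card_2_iff)
  have nA: "10 * m \<le> 10 * card {b \<in> A. {a, r, b} \<in> E} + card S" if "r \<in> S" "r \<notin> H" for r
  proof -
    have "{w \<in> A \<union> S. {a, r, w} \<in> E} = {b \<in> A. {a, r, b} \<in> E} \<union> {t \<in> S. {a, r, t} \<in> E}" by auto
    then have "card {w \<in> A \<union> S. {a, r, w} \<in> E} = card ({b \<in> A. {a, r, b} \<in> E} \<union> {t \<in> S. {a, r, t} \<in> E})"
      by (rule arg_cong)
    also have "\<dots> \<le> card {b \<in> A. {a, r, b} \<in> E} + deg r"
      unfolding deg_def by (rule card_Un_le)
    finally have "card {w \<in> A \<union> S. {a, r, w} \<in> E} \<le> card {b \<in> A. {a, r, b} \<in> E} + deg r" .
    moreover have "10 * deg r \<le> card S" using that by (auto simp: H_def)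
    ultimately show ?thesis using pair_across[OF aA \<open>r \<in> S\<close>] by linarith
  qed
  define N where "N r = {b \<in> A. {a, r, b} \<in> E}" for r
  have "card (N s) + card (N t) = card (N s \<union> N t) + card (N s \<inter> N t)"
    using finA by (intro card_Un_Int) (auto simp: N_def)
  moreover have "card (N s \<union> N t) \<le> m + k"
    unfolding cardA[symmetric] using finA by (intro card_mono) (auto simp: N_def)
  moreover have "10 * m \<le> 10 * card (N s) + card S" "10 * m \<le> 10 * card (N t) + card S"
    using nA st by (simp_all add: N_def)
  ultimately have "card U < card (N s \<inter> N t)"
    using U(2) sizes by linarith
  then have "\<not> N s \<inter> N t \<subseteq> U" using U card_mono by (metis not_le)
  then obtain b where b: "b \<in> A" "b \<notin> U" "{a, s, b} \<in> E" "{a, t, b} \<in> E" by (auto simp: N_def)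
  have d: "a \<noteq> s" "a \<noteq> b" "s \<noteq> b" "a \<noteq> t" using edge_distinct[OF b(3)] edge_distinct[OF b(4)] by auto
  then have "s \<notin> {a, t, b}" using st by auto
  then have "{a, s, b} \<noteq> {a, t, b}" by blast
  then have "spans_D E {a, b, s, t}" by (rule spans_DI[OF b(3,4)]) auto
  then have "mixed_tile 2 {a, b, s, t}" using aA b st d by (intro mixed_tile_2I) auto
  then show ?thesis using U b st by (intro exI[of _ "{a, b, s, t}"]) auto
qed

text \<open>
  Any edge $ast$ with $s, t \<in> S$ extends to a tile, because $s$ and $t$ have at least $m - 1$ neighbours
  in $A$. Such an edge is found inside a tile of the type one plus three: of two edges there, at most one
  is the triple in $S$.
\<close>

lemma dense_tile_2:
  assumes a: "a \<in> A - sparse" and U: "finite U" "card U \<le> 200 * K" "a \<notin> U"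
  shows "\<exists>X. mixed_tile 2 X \<and> a \<in> X \<and> X \<inter> U = {}"
proof -
  obtain T where T: "mixed_tile 1 T" "a \<in> T" "T \<inter> U = {}" using dense_tile_1[OF assms] by blast
  have "card (T \<inter> A) = 1" using T(1) by (simp add: mixed_tile_def)
  moreover have "a \<in> T \<inter> A" using T a by simp
  ultimately have TA: "T \<inter> A = {a}" by (metis card_1_singletonE singletonD)
  obtain e f where ef: "e \<in> E" "f \<in> E" "e \<noteq> f" "e \<subseteq> T" "f \<subseteq> T" using T(1) by (auto simp: mixed_tile_def spans_D_def)
  have "card (T \<inter> S) = 3" "T \<subseteq> A \<union> S" using T(1) by (auto simp: mixed_tile_def)
  have "a \<in> e \<or> a \<in> f"
  proof (rule ccontr)
    assume "\<not> ?thesis"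
    moreover have "T - {a} \<subseteq> T \<inter> S" using TA \<open>T \<subseteq> A \<union> S\<close> by auto
    ultimately have "e \<subseteq> T \<inter> S" "f \<subseteq> T \<inter> S" using ef(4,5) by auto
    moreover have "finite (T \<inter> S)" using finS by auto
    ultimately show False using ef edge_card \<open>card (T \<inter> S) = 3\<close> by (metis card_subset_eq)
  qed
  then obtain g where g: "g \<in> E" "a \<in> g" "g \<subseteq> T" using ef by blast
  have "card (g - {a}) = 2" using g edge_card[of g] by simp
  then obtain s t where st: "g - {a} = {s, t}" "s \<noteq> t" by (auto simp: card_2_iff)
  then have "g = {a, s, t}" using g(2) by blast
  then have ast: "{a, s, t} \<in> E" using g(1) by simp
  have "{s, t} \<subseteq> T - {a}" using st(1) g(3) by blast
  then have stS: "s \<in> S" "t \<in> S" "s \<notin> U" "t \<notin> U"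
    using TA \<open>T \<subseteq> A \<union> S\<close> T(3) by auto
  have "card (insert a U) < card {b \<in> A. {b, s, t} \<in> E}"
    using pair_in_S[OF stS(1,2) st(2)] U sizes by simp
  then have "\<not> {b \<in> A. {b, s, t} \<in> E} \<subseteq> insert a U" using U card_mono by (metis not_le finite_insert)
  then obtain b where b: "b \<in> A" "b \<noteq> a" "b \<notin> U" "{b, s, t} \<in> E" by blast
  have "b \<notin> {a, s, t}" using b stS disj by auto
  then have "{a, s, t} \<noteq> {b, s, t}" by blast
  then have "spans_D E {a, b, s, t}" by (rule spans_DI[OF ast b(4)]) auto
  then have "mixed_tile 2 {a, b, s, t}" using a b stS st by (intro mixed_tile_2I) auto
  then show ?thesis using U b stS by (intro exI[of _ "{a, b, s, t}"]) auto
qed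

section \<open>Covering the sparse vertices\<close>

text \<open>
  Let $|\<open>sparse\<close>| = k + j$ with $j \<ge> 2$. By \<open>sum_link_size\<close> the links of the sparse vertices contain at least
  $(j - 1)|S|(|S| - 1)$ ordered pairs altogether. The at most $j - 1$ vertices chosen already account for less
  than $|S|^2/40$ pairs each, and the pairs that meet the used part of $S$ are
  negligible since there are only $O(K)$ sparse vertices. Hence some unused sparse vertex still has a tile.
  This fails for $j = 1$, where the lower bound is $0$; then the single tile is provided by \<open>saturated\<close>.
\<close>

lemma sparse_1_packing:
  assumes "i \<le> card sparse - k"
  shows "\<exists>F. packing 1 F \<and> card F = i \<and> \<Union>F \<inter> A \<subseteq> sparse"
  using assms
proof (induction i)
  case 0
  show ?case by (intro exI[of _ "{}"]) (auto simp: packing_def)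
next
  case (Suc i)
  then obtain F where F: "packing 1 F" "card F = i" "\<Union>F \<inter> A \<subseteq> sparse" by auto
  define B1 W where "B1 = \<Union>F \<inter> A" and "W = \<Union>F \<inter> S"
  have cB: "card B1 = i" and cW: "card W = 3 * i" using card_packing[OF F(1)] F(2) by (auto simp: B1_def W_def)
  have fin: "finite B1" "finite W" using finA finS by (auto simp: B1_def W_def)
  have "\<exists>a T. a \<in> sparse - B1 \<and> T \<subseteq> S - W \<and> card T = 3 \<and> spans_D E (insert a T)"
  proof (cases "card sparse - k = 1")
    case True
    then have "i = 0" using Suc.prems by simp
    then have "F = {}" using F by (auto simp: packing_def)
    moreover obtain a where "a \<in> sparse" using True by fastforce
    ultimately show ?thesis using saturated[of a] sparse_subset by (auto simp: B1_def W_def)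
  next
    case False
    show ?thesis
    proof (rule ccontr)
      assume none: "\<not> ?thesis"
      \<comment> \<open>The number called j - 1 above; it is positive, which makes the lower bound useful.\<close>
      define d where "d = card sparse - k - 1"
      have d: "1 \<le> d" "i \<le> d" "card sparse = K + d" using False Suc.prems sizes(1) by (auto simp: d_def)
      obtain M where M: "card S = Suc M" using sizes
        by (cases "card S") auto
      have small: "link_size a \<le> (6 * i + 1) * card S" if "a \<in> sparse - B1" for a
        using none cherry_of_large_link[of a W] that fin cW sparse_subset by (force simp: not_le[symmetric])
      have "40 * (\<Sum>a\<in>sparse. link_size a) = (\<Sum>a\<in>sparse. 40 * link_size a)"
        by (rule sum_distrib_left)
      also have "\<dots> = (\<Sum>a\<in>sparse - B1. 40 * link_size a) + (\<Sum>a\<in>B1. 40 * link_size a)"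
        using F(3) finite_sparse by (intro sum.subset_diff) (auto simp: B1_def)
      also have "\<dots> \<le> (\<Sum>a\<in>sparse - B1. 40 * ((6 * i + 1) * card S)) + (\<Sum>a\<in>B1. card S * card S)"
      proof (intro add_mono sum_mono)
        fix a assume "a \<in> sparse - B1"
        then show "40 * link_size a \<le> 40 * ((6 * i + 1) * card S)" using small by (intro mult_left_mono) auto
      next
        fix a assume "a \<in> B1"
        then show "40 * link_size a \<le> card S * card S" using F(3) by (auto simp: B1_def sparse_def)
      qed
      also have "\<dots> = card (sparse - B1) * (40 * ((6 * i + 1) * card S)) + i * (card S * card S)"
        by (simp add: cB)
      also have "\<dots> \<le> (2 * K) * (40 * ((7 * d) * card S)) + d * (card S * card S)"
      proof (intro add_mono mult_mono)
        show "card (sparse - B1) \<le> 2 * K"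
          using card_sparse card_mono[OF finite_sparse, of "sparse - B1"] by auto
        show "6 * i + 1 \<le> 7 * d" using d by linarith
      qed (use d in auto)
      finally have 1: "40 * (\<Sum>a\<in>sparse. link_size a) \<le> d * card S * (560 * K + card S)"
        by (simp add: algebra_simps)
      have "d * (card S * M) \<le> (\<Sum>a\<in>sparse. link_size a)"
        using sum_link_size[OF sparse_subset] d(3) M by (simp add: algebra_simps)
      then have "(d * card S) * (40 * M) \<le> (d * card S) * (560 * K + card S)"
        using 1 by (simp add: algebra_simps)
      then have "40 * M \<le> 560 * K + card S"
        using d(1) M by (simp only: mult_le_cancel1) simp
      then show False using M sizes by linarith
    qed
  qed
  then obtain a T where aT: "a \<in> sparse - B1" "T \<subseteq> S - W" "card T = 3" "spans_D E (insert a T)" by blast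
  then have t: "mixed_tile 1 (insert a T)" using sparse_subset by (intro mixed_tile_1I) auto
  have "a \<notin> \<Union>F" using aT sparse_subset by (auto simp: B1_def)
  moreover have "T \<inter> \<Union>F = {}" using aT(2) by (auto simp: W_def)
  ultimately have dis: "insert a T \<inter> \<Union>F = {}" by auto
  have "insert a T \<inter> A \<subseteq> sparse" using aT disj by auto
  then show ?case
    using packing_insert[OF F(1) t dis] F(2,3) by (intro exI[of _ "insert (insert a T) F"]) auto
qed

lemma greedy_packing:
  assumes I: "I \<subseteq> A" "card I \<le> 20 * K" and U: "finite U" "I \<inter> U = {}" "card U \<le> 50 * K"
    and pick: "\<And>a V. a \<in> I \<Longrightarrow> finite V \<Longrightarrow> card V \<le> 200 * K \<Longrightarrow> a \<notin> V \<Longrightarrow> \<exists>X. mixed_tile i X \<and> a \<in> X \<and> X \<inter> V = {}"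
    and i: "i \<le> 4"
  shows "\<exists>F. packing i F \<and> card F = card I \<and> \<Union>F \<inter> U = {} \<and> I \<subseteq> \<Union>F"
proof -
  have "finite I" using I finA finite_subset by blast
  have "4 * card I + card U \<le> 200 * K" using I U by linarith
  then have "\<exists>F. finite F \<and> card F = card I \<and> (\<forall>X\<in>F. mixed_tile i X) \<and> pairwise disjnt F \<and>
      \<Union>F \<inter> U = {} \<and> I \<subseteq> \<Union>F"
    by (intro greedy_disjoint_cover[where c = 4 and N = "200 * K"])
      (use \<open>finite I\<close> U pick card_mixed_tile(1)[OF _ i] in auto)
  then obtain F where "finite F" "card F = card I" "\<forall>X\<in>F. mixed_tile i X" "pairwise disjnt F" "\<Union>F \<inter> U = {}" "I \<subseteq> \<Union>F"
    by blast
  then show ?thesis by (auto simp: packing_def)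
qed

section \<open>Completing the tiling\<close>

text \<open>
  If $a$ is joined to two of the three pairs of $T$, then it forms a tile with $T$; hence an incompatible
  $a$ is missed by one of two fixed pairs of $T$.
\<close>

lemma card_incompatible:
  assumes T: "T \<subseteq> S" "card T = 3"
  shows "card {a \<in> A. \<not> spans_D E (insert a T)} \<le> 2 * K"
proof -
  obtain x y z where xyz: "T = {x, y, z}" "x \<noteq> y" "x \<noteq> z" "y \<noteq> z" using T by (auto simp: card_3_iff)
  have "{a \<in> A. \<not> spans_D E (insert a T)} \<subseteq> {a \<in> A. {a, x, y} \<notin> E} \<union> {a \<in> A. {a, x, z} \<notin> E}"
  proof (rule ccontr)
    assume "\<not> ?thesis"
    then obtain a where a: "a \<in> A" "\<not> spans_D E (insert a T)" "{a, x, y} \<in> E" "{a, x, z} \<in> E" by blast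
    have "y \<notin> {a, x, z}" using edge_distinct[OF a(3)] xyz by auto
    then have "{a, x, y} \<noteq> {a, x, z}" by blast
    then have "spans_D E (insert a T)" by (rule spans_DI[OF a(3,4)]) (auto simp: xyz)
    then show False using a(2) by simp
  qed
  then have "card {a \<in> A. \<not> spans_D E (insert a T)} \<le> card ({a \<in> A. {a, x, y} \<notin> E} \<union> {a \<in> A. {a, x, z} \<notin> E})"
    using finA by (intro card_mono) auto
  also have "\<dots> \<le> card {a \<in> A. {a, x, y} \<notin> E} + card {a \<in> A. {a, x, z} \<notin> E}" by (rule card_Un_le)
  finally show ?thesis using card_missing[of x y] card_missing[of x z] xyz T by simp
qed

text \<open>
  A vertex of $A'$ may be incompatible with many triples of a fixed partition of $S'$, although each
  triple is incompatible with few vertices. The set $X$ of all such vertices has at most $20K$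
  elements and is tiled first, which damages at most $3|X|$ triples. The new partition contains every
  undamaged triple, so the other vertices stay compatible with most of it.
\<close>

lemma packing_of_balanced_part:
  assumes A': "A' \<subseteq> A - sparse" and S': "S' \<subseteq> S" and balanced: "card S' = 3 * card A'"
    and rest: "card (A \<union> S - (A' \<union> S')) \<le> 50 * K"
  shows "\<exists>F. packing 1 F \<and> card F = card A' \<and> \<Union>F \<subseteq> A' \<union> S'"
proof -
  define N where "N = card A'"
  define incompatible where "incompatible P a = {T \<in> P. \<not> spans_D E (insert a T)}" for P a
  have fin: "finite A'" "finite S'" using A' S' finA finS by (auto intro: finite_subset)
  have "A - A' \<subseteq> A \<union> S - (A' \<union> S')" using disj S' by auto
  then have "card (A - A') \<le> 50 * K" using rest finA finS by (meson card_mono finite_Diff finite_Un le_trans)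
  then have N: "m \<le> N + 50 * K"
    using A' fin finA cardA by (subst (asm) card_Diff_subset) (auto simp: N_def)
  obtain P where P: "P \<subseteq> Pow S'" "pairwise disjnt P" "\<forall>T\<in>P. card T = 3" "card P = N"
    using extend_to_triple_partition[of S' N "{}"] fin balanced by (auto simp: N_def)
  have finP: "finite P" using P(1) fin by (meson finite_Pow_iff finite_subset)
  define X where "X = {a \<in> A'. N \<le> 10 * card (incompatible P a)}"
  have XA: "X \<subseteq> A'" and finX: "finite X" using fin by (auto simp: X_def)
  have "card X * N = (\<Sum>a\<in>X. N)" by simp
  also have "\<dots> \<le> (\<Sum>a\<in>X. 10 * card (incompatible P a))" by (rule sum_mono) (auto simp: X_def)
  also have "\<dots> \<le> (\<Sum>a\<in>A'. 10 * card (incompatible P a))"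
    using fin by (intro sum_mono2) (auto simp: X_def)
  also have "\<dots> = 10 * (\<Sum>a\<in>A'. card {T \<in> P. \<not> spans_D E (insert a T)})"
    by (simp add: sum_distrib_left incompatible_def)
  also have "(\<Sum>a\<in>A'. card {T \<in> P. \<not> spans_D E (insert a T)}) = (\<Sum>T\<in>P. card {a \<in> A'. \<not> spans_D E (insert a T)})"
    using fin finP by (intro sum_multicount_gen) auto
  also have "\<dots> \<le> (\<Sum>T\<in>P. 2 * K)"
  proof (rule sum_mono)
    fix T assume T: "T \<in> P"
    have "card {a \<in> A'. \<not> spans_D E (insert a T)} \<le> card {a \<in> A. \<not> spans_D E (insert a T)}"
      using A' finA by (intro card_mono) auto
    also have "\<dots> \<le> 2 * K" using T P S' by (intro card_incompatible) auto
    finally show "card {a \<in> A'. \<not> spans_D E (insert a T)} \<le> 2 * K" .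
  qed
  finally have "card X * N \<le> (20 * K) * N" by (simp add: P(4) algebra_simps)
  moreover have "0 < N" using N sizes by linarith
  ultimately have cX: "card X \<le> 20 * K" by (simp only: mult_le_cancel2)
  define Z where "Z = A \<union> S - (A' \<union> S')"
  have Z: "finite Z" using finA finS by (simp add: Z_def)
  obtain F where F: "packing 1 F" "card F = card X" "\<Union>F \<inter> Z = {}" "X \<subseteq> \<Union>F"
  proof -
    have "\<exists>F. packing 1 F \<and> card F = card X \<and> \<Union>F \<inter> Z = {} \<and> X \<subseteq> \<Union>F"
      by (rule greedy_packing) (use XA A' cX Z rest dense_tile_1 in \<open>auto simp: Z_def\<close>)
    then show ?thesis using that by blast
  qed
  have FAS: "\<Union>F \<subseteq> A' \<union> S'"
    using F(1,3) by (fastforce simp: packing_def mixed_tile_def Z_def)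
  have "X \<subseteq> \<Union>F \<inter> A" using F XA A' by auto
  moreover have "card (\<Union>F \<inter> A) = card X" using card_packing(1)[OF F(1)] F(2) by simp
  ultimately have FA: "\<Union>F \<inter> A = X" using finA by (metis card_subset_eq finite_Int)
  define W where "W = \<Union>F \<inter> S"
  have cW: "card W = 3 * card X" using card_packing(2)[OF F(1)] F(2) by (simp add: W_def)
  have finW: "finite W" using finS by (simp add: W_def)
  have WS: "W \<subseteq> S'" using FAS A' disj by (auto simp: W_def)
  define A2 S2 where "A2 = A' - X" and "S2 = S' - W"
  have cA2: "card A2 + card X = N" unfolding A2_def N_def using XA fin finX
    by (metis card_Diff_subset card_mono le_add_diff_inverse2)
  have cS2: "card S2 = 3 * card A2"
    using WS finW balanced cA2 cW by (simp add: S2_def card_Diff_subset N_def)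
  define P1 where "P1 = {T \<in> P. T \<inter> W = {}}"
  have "\<exists>P2. P1 \<subseteq> P2 \<and> P2 \<subseteq> Pow S2 \<and> pairwise disjnt P2 \<and> (\<forall>T\<in>P2. card T = 3) \<and> card P2 = card A2"
  proof (rule extend_to_triple_partition)
    show "pairwise disjnt P1" using P(2) by (rule pairwise_subset) (auto simp: P1_def)
  qed (use fin cS2 P in \<open>auto simp: S2_def P1_def\<close>)
  then obtain P2 where P2: "P1 \<subseteq> P2" "P2 \<subseteq> Pow S2" "pairwise disjnt P2" "\<forall>T\<in>P2. card T = 3" "card P2 = card A2"
    by blast
  have finP2: "finite P2" using P2(2) fin by (simp add: S2_def finite_subset[of P2 "Pow (S' - W)"])
  \<comment> \<open>Damaged triples are disjoint and each contains a vertex of W.\<close>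
  have hit: "card (P - P1) \<le> card W"
  proof -
    have "\<forall>T\<in>P - P1. \<exists>w. w \<in> T \<inter> W" by (auto simp: P1_def)
    then obtain g where g: "\<And>T. T \<in> P - P1 \<Longrightarrow> g T \<in> T \<inter> W" by metis
    have "inj_on g (P - P1)"
    proof (rule inj_onI)
      fix T T' assume "T \<in> P - P1" "T' \<in> P - P1" "g T = g T'"
      then have "\<not> disjnt T T'" using g by (metis disjnt_iff IntD1)
      then show "T = T'" using P(2) \<open>T \<in> P - P1\<close> \<open>T' \<in> P - P1\<close> by (auto simp: pairwise_def)
    qed
    then show ?thesis using g finW by (intro card_inj_on_le[of g]) auto
  qed
  have "card (P2 - P1) = card P2 - card P1" using P2(1) finP2 by (meson card_Diff_subset finite_subset)
  moreover have "card (P - P1) = card P - card P1" using finP by (intro card_Diff_subset) (auto simp: P1_def)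
  ultimately have new: "card (P2 - P1) \<le> 3 * card X"
    using hit cW P2(5) P(4) cA2 by linarith
  have "\<exists>f. bij_betw f A2 P2 \<and> (\<forall>a\<in>A2. spans_D E (insert a (f a)))"
  proof (rule swap_bijection)
    show "card {T \<in> P2. \<not> spans_D E (insert a T)} \<le> N div 10 + 3 * card X" if "a \<in> A2" for a
    proof -
      have "{T \<in> P2. \<not> spans_D E (insert a T)} \<subseteq> incompatible P a \<union> (P2 - P1)"
        by (auto simp: incompatible_def P1_def)
      moreover have "finite (incompatible P a)" using finP by (simp add: incompatible_def)
      ultimately have "card {T \<in> P2. \<not> spans_D E (insert a T)} \<le> card (incompatible P a \<union> (P2 - P1))"
        using finP2 by (intro card_mono) auto
      also have "\<dots> \<le> card (incompatible P a) + card (P2 - P1)" by (rule card_Un_le)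
      finally show ?thesis using that new by (auto simp: A2_def X_def)
    qed
    show "card {a \<in> A2. \<not> spans_D E (insert a T)} \<le> 2 * K" if "T \<in> P2" for T
    proof -
      have "card {a \<in> A2. \<not> spans_D E (insert a T)} \<le> card {a \<in> A. \<not> spans_D E (insert a T)}"
        using A' finA by (intro card_mono) (auto simp: A2_def)
      moreover have "T \<subseteq> S2" using that P2(2) by blast
      then have "card {a \<in> A. \<not> spans_D E (insert a T)} \<le> 2 * K"
        using that P2(4) S' by (intro card_incompatible) (auto simp: S2_def)
      ultimately show ?thesis by linarith
    qed
    show "N div 10 + 3 * card X + 2 * K < card A2"
      using cA2 cX N sizes by linarith
  qed (use fin finP2 P2 in \<open>auto simp: A2_def\<close>)
  then obtain f where f: "bij_betw f A2 P2" "\<forall>a\<in>A2. spans_D E (insert a (f a))" by blast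
  have fP: "f a \<in> P2" if "a \<in> A2" for a using f(1) that by (auto dest: bij_betwE)
  have fS: "f a \<subseteq> S2" if "a \<in> A2" for a using fP[OF that] P2 by auto
  have nA2: "A2 \<inter> S2 = {}" using A' S' disj by (auto simp: A2_def S2_def)
  define F' where "F' = (\<lambda>a. insert a (f a)) ` A2"
  have "inj_on (\<lambda>a. insert a (f a)) A2" using fS nA2 by (intro inj_onI) blast
  then have cF': "card F' = card A2" unfolding F'_def by (rule card_image)
  have "pairwise disjnt F'"
  proof (unfold F'_def pairwise_image, rule pairwiseI)
    fix a b assume ab: "a \<in> A2" "b \<in> A2" "a \<noteq> b"
    then have "f a \<noteq> f b" using f(1) by (auto simp: bij_betw_def inj_on_def)
    then have "f a \<inter> f b = {}" using fP ab P2(3) by (auto simp: pairwise_def disjnt_def)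
    then show "insert a (f a) \<noteq> insert b (f b) \<longrightarrow> disjnt (insert a (f a)) (insert b (f b))"
      using fS[OF ab(1)] fS[OF ab(2)] ab nA2 by (auto simp: disjnt_def)
  qed
  moreover have "mixed_tile 1 (insert a (f a))" if a: "a \<in> A2" for a
    using a A' fS[OF a] S' P2(4) fP[OF a] f(2) by (intro mixed_tile_1I) (auto simp: A2_def S2_def)
  ultimately have pF': "packing 1 F'" using fin by (auto simp: packing_def F'_def A2_def)
  have "\<Union>F' \<subseteq> A2 \<union> S2" using fS by (auto simp: F'_def)
  have "\<Union>F \<subseteq> X \<union> W" using FA FAS A' S' by (auto simp: W_def)
  then have dj: "\<Union>F \<inter> \<Union>F' = {}"
    using \<open>\<Union>F' \<subseteq> A2 \<union> S2\<close> XA WS A' S' disj unfolding A2_def S2_def by blast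
  have "{} \<notin> F" using F(1) card_mixed_tile(1)[of 1 "{}"] by (auto simp: packing_def)
  have "F \<inter> F' = {}"
    using dj \<open>{} \<notin> F\<close> by (intro families_disjoint)
  moreover have "finite F" "finite F'" using F(1) pF' by (auto simp: packing_def)
  ultimately have "card (F \<union> F') = card A'" using F(2) cF' cA2 by (simp add: card_Un_disjoint N_def)
  moreover have "pairwise disjnt (F \<union> F')"
    using F(1) pF' dj by (intro pairwise_disjnt_Un) (auto simp: packing_def)
  then have "packing 1 (F \<union> F')" using F(1) pF' by (auto simp: packing_def)
  moreover have "\<Union>(F \<union> F') \<subseteq> A' \<union> S'"
    using FAS \<open>\<Union>F' \<subseteq> A2 \<union> S2\<close> by (auto simp: A2_def S2_def)
  ultimately show ?thesis by blast
qed

text \<open>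
  With $j$ tiles for surplus sparse vertices and $k$ tiles of the type two plus two, the unused parts of
  $A$ and $S$ have sizes $m + k - j - 2k$ and $3m - k - 3j - 2k$, and the second is three times the first.
\<close>

theorem perfect_tiling:
  "\<exists>F. finite F \<and> card F = m \<and> pairwise disjnt F \<and> (\<forall>X\<in>F. X \<subseteq> A \<union> S \<and> card X = 4 \<and> spans_D E X)"
proof -
  define j where "j = card sparse - k"
  obtain F1 where F1: "packing 1 F1" "card F1 = j" "\<Union>F1 \<inter> A \<subseteq> sparse"
    using sparse_1_packing[of j] by (auto simp: j_def)
  have jK: "j \<le> 2 * K" using card_sparse by (simp add: j_def)
  define B1 where "B1 = \<Union>F1 \<inter> A"
  have cB1: "card B1 = j" using card_packing[OF F1(1)] F1(2) by (simp add: B1_def)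
  have finB1: "finite B1" using finA by (simp add: B1_def)
  have "card (sparse - B1) \<le> k"
    using F1(3) finB1 cB1 by (subst card_Diff_subset) (auto simp: B1_def j_def)
  moreover have "k \<le> card (A - B1)"
    using finB1 finA cardA cB1 jK sizes by (subst card_Diff_subset) (auto simp: B1_def)
  \<comment> \<open>Padding the remaining sparse vertices to a set of size exactly k fixes the balance at the same time.\<close>
  ultimately obtain C where C: "sparse - B1 \<subseteq> C" "C \<subseteq> A - B1" "card C = k"
    using exists_subset_between[of "sparse - B1" k "A - B1"] sparse_subset finA by auto
  have F1c: "finite (\<Union>F1)" "card (\<Union>F1) = 4 * j"
  proof -
    have *: "\<And>X. X \<in> F1 \<Longrightarrow> finite X \<and> card X = 4" using F1(1) card_mixed_tile[of 1] by (auto simp: packing_def)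
    then show "finite (\<Union>F1)" using F1(1) by (auto simp: packing_def)
    show "card (\<Union>F1) = 4 * j"
      using * F1 by (subst card_Union_disjoint) (auto simp: packing_def)
  qed
  have "\<exists>F. packing 2 F \<and> card F = card C \<and> \<Union>F \<inter> \<Union>F1 = {} \<and> C \<subseteq> \<Union>F"
  proof (rule greedy_packing)
    show "C \<subseteq> A" "C \<inter> \<Union>F1 = {}" using C by (auto simp: B1_def)
    show "\<exists>X. mixed_tile 2 X \<and> a \<in> X \<and> X \<inter> V = {}"
      if "a \<in> C" "finite V" "card V \<le> 200 * K" "a \<notin> V" for a V
      using that C dense_tile_2[of a V] sparse_tile_2[of a V] by blast
    have "k \<le> 20 * K" using sizes(1) by simp
    then show "card C \<le> 20 * K" by (simp only: C(3))
  qed (use F1c jK in auto)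
  then obtain F2 where F2: "packing 2 F2" "card F2 = k" "\<Union>F2 \<inter> \<Union>F1 = {}" "C \<subseteq> \<Union>F2" using C by auto
  have F2c: "finite (\<Union>F2)" "card (\<Union>F2) = 4 * k"
  proof -
    have *: "\<And>X. X \<in> F2 \<Longrightarrow> finite X \<and> card X = 4" using F2(1) card_mixed_tile[of 2] by (auto simp: packing_def)
    then show "finite (\<Union>F2)" using F2(1) by (auto simp: packing_def)
    show "card (\<Union>F2) = 4 * k"
      using * F2 by (subst card_Union_disjoint) (auto simp: packing_def)
  qed
  define Z where "Z = \<Union>F1 \<union> \<Union>F2"
  have ZAS: "Z \<subseteq> A \<union> S" using F1(1) F2(1) by (auto simp: Z_def packing_def mixed_tile_def)
  have finZ: "finite Z" using F1c F2c by (simp add: Z_def)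
  have "card Z \<le> 4 * j + 4 * k" using card_Un_le[of "\<Union>F1" "\<Union>F2"] F1c F2c by (simp add: Z_def)
  have ZA: "card (Z \<inter> A) = j + 2 * k"
  proof -
    have "Z \<inter> A = (\<Union>F1 \<inter> A) \<union> (\<Union>F2 \<inter> A)" by (auto simp: Z_def)
    then have "card (Z \<inter> A) = card (\<Union>F1 \<inter> A) + card (\<Union>F2 \<inter> A)"
      using F2(3) finA by (simp only:) (rule card_Un_disjoint, auto)
    then show ?thesis using card_packing(1)[OF F1(1)] card_packing(1)[OF F2(1)] F1(2) F2(2) by simp
  qed
  have ZS: "card (Z \<inter> S) = 3 * j + 2 * k"
  proof -
    have "Z \<inter> S = (\<Union>F1 \<inter> S) \<union> (\<Union>F2 \<inter> S)" by (auto simp: Z_def)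
    then have "card (Z \<inter> S) = card (\<Union>F1 \<inter> S) + card (\<Union>F2 \<inter> S)"
      using F2(3) finS by (simp only:) (rule card_Un_disjoint, auto)
    then show ?thesis using card_packing(2)[OF F1(1)] card_packing(2)[OF F2(1)] F1(2) F2(2) by simp
  qed
  have cA': "card (A - Z) = m - k - j"
    using ZA finA cardA card_Diff_subset_Int[of A Z] by (simp add: Int_commute)
  have cS': "card (S - Z) = 3 * m - k - (3 * j + 2 * k)"
    using ZS finS cardS card_Diff_subset_Int[of S Z] by (simp add: Int_commute)
  have "\<exists>F. packing 1 F \<and> card F = card (A - Z) \<and> \<Union>F \<subseteq> (A - Z) \<union> (S - Z)"
  proof (rule packing_of_balanced_part)
    show "A - Z \<subseteq> A - sparse" using C(1) F2(4) by (auto simp: Z_def B1_def)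
    show "card (S - Z) = 3 * card (A - Z)" using cA' cS' by simp
    have "A \<union> S - (A - Z \<union> (S - Z)) = Z" using ZAS by auto
    then show "card (A \<union> S - (A - Z \<union> (S - Z))) \<le> 50 * K"
      using \<open>card Z \<le> 4 * j + 4 * k\<close> jK sizes(1) by simp
  qed auto
  then obtain F3 where F3: "packing 1 F3" "card F3 = m - k - j" "\<Union>F3 \<subseteq> (A - Z) \<union> (S - Z)"
    using cA' by auto
  let ?F = "F1 \<union> F2 \<union> F3"
  have t: "X \<subseteq> A \<union> S \<and> card X = 4 \<and> spans_D E X" if "X \<in> ?F" for X
  proof -
    have "mixed_tile 1 X \<or> mixed_tile 2 X"
      using that F1(1) F2(1) F3(1) unfolding packing_def by blast
    then obtain i where "mixed_tile i X" "i \<le> 4" by fastforce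
    then show ?thesis using card_mixed_tile(1)[of i X] by (simp add: mixed_tile_def)
  qed
  have ne: "{} \<notin> ?F" using t[of "{}"] by auto
  have d3: "\<Union>F3 \<inter> (\<Union>F1 \<union> \<Union>F2) = {}" using F3(3) by (auto simp: Z_def)
  have fin: "finite F1" "finite F2" "finite F3" using F1 F2 F3 by (auto simp: packing_def)
  have "F1 \<inter> F2 = {}" "(F1 \<union> F2) \<inter> F3 = {}"
    using ne by (intro families_disjoint; use F2(3) d3 in \<open>simp add: Int_commute\<close>)+
  then have "card ?F = j + k + (m - k - j)" using fin F1(2) F2(2) F3(2) by (simp add: card_Un_disjoint)
  then have "card ?F = m" using jK sizes by simp
  moreover have "pairwise disjnt ?F"
  proof (intro pairwise_disjnt_Un)
    show "\<Union>F1 \<inter> \<Union>F2 = {}" using F2(3) by (simp add: Int_commute)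
    show "\<Union>(F1 \<union> F2) \<inter> \<Union>F3 = {}" using d3 by (simp add: Int_commute)
  qed (use F1(1) F2(1) F3(1) in \<open>simp_all add: packing_def\<close>)
  ultimately show ?thesis using t fin by (intro exI[of _ ?F]) auto
qed

end

section \<open>The extremal case\<close>

lemma D_free_iff:
  assumes "three_graph G" "S \<subseteq> hverts G"
  shows "D_free (induced G S) \<longleftrightarrow> \<not> (\<exists>X \<subseteq> S. card X = 4 \<and> spans_D (hedges G) X)"
proof -
  have e3: "e \<in> hedges G \<Longrightarrow> card e = 3" for e
    using assms by (auto simp: three_graph_def nsets_def)
  have finS: "finite S" using assms by (auto simp: three_graph_def intro: finite_subset)
  have "(\<exists>H. D_copy_in H (induced G S)) \<longleftrightarrow> (\<exists>X \<subseteq> S. card X = 4 \<and> spans_D (hedges G) X)" (is "?L \<longleftrightarrow> ?R")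
  proof
    assume ?L
    then obtain H where "D_copy_in H (induced G S)" by blast
    then have "is_D H" "hverts H \<subseteq> S" "hedges H \<subseteq> {e \<in> hedges G. e \<subseteq> S}"
      by (simp_all add: D_copy_in_def subhypergraph_def induced_def hverts_def hedges_def)
    then have H: "three_graph H" "card (hverts H) = 4" "card (hedges H) = 2"
      "hverts H \<subseteq> S" "hedges H \<subseteq> hedges G"
      unfolding is_D_def by blast+
    then obtain e f where ef: "hedges H = {e, f}" "e \<noteq> f" by (auto simp: card_2_iff)
    then have "e \<subseteq> hverts H" "f \<subseteq> hverts H" using H(1) by (auto simp: three_graph_def nsets_def)
    then have "spans_D (hedges G) (hverts H)"
      using H(5) ef by (intro spans_DI[of e _ f]) auto
    then show ?R using H(2,4) by blast
  next
    assume ?R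
    then obtain X e f where X: "X \<subseteq> S" "card X = 4" "e \<in> hedges G" "f \<in> hedges G" "e \<noteq> f" "e \<subseteq> X" "f \<subseteq> X"
      by (auto simp: spans_D_def)
    have "finite X" using X finS finite_subset by blast
    moreover from this have "finite e" "finite f" using X finite_subset by blast+
    ultimately have "D_copy_in (X, {e, f}) (induced G S)"
      using X e3[OF X(3)] e3[OF X(4)] by (auto simp: D_copy_in_def is_D_def subhypergraph_def induced_def hverts_def
          hedges_def three_graph_def nsets_def)
    then show ?L by blast
  qed
  then show ?thesis by (simp add: D_free_def)
qed

lemma min_codegree_le:
  assumes G: "three_graph G" and uv: "u \<in> hverts G" "v \<in> hverts G" "u \<noteq> v"
  shows "min_codegree G \<le> card (nbhd G u v)"
proof -
  let ?C = "{card (nbhd G u v) | u v. {u, v} \<in> nsets (hverts G) 2}"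
  have "?C \<subseteq> (\<lambda>(u, v). card (nbhd G u v)) ` (hverts G \<times> hverts G)"
    by (auto simp: nsets_def)
  moreover have "finite (hverts G)" using G by (simp add: three_graph_def)
  ultimately have "finite ?C" by (meson finite_SigmaI finite_imageI finite_subset)
  moreover have "{u, v} \<in> nsets (hverts G) 2" using uv by (auto simp: nsets_def)
  then have "card (nbhd G u v) \<in> ?C" by blast
  ultimately show ?thesis unfolding min_codegree_def by (rule Min_le)
qed

lemma D_tileable_if_disjoint_tiles:
  assumes G: "three_graph G" and F: "finite F" "card F = order_of G div 4" "pairwise disjnt F"
    and t: "\<And>X. X \<in> F \<Longrightarrow> X \<subseteq> hverts G \<and> card X = 4 \<and> spans_D (hedges G) X"
  shows "D_tileable G"
proof -
  have "\<exists>H. D_copy_in H G \<and> hverts H = X" if XF: "X \<in> F" for X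
  proof -
    obtain e f where X: "e \<in> hedges G" "f \<in> hedges G" "e \<noteq> f" "e \<subseteq> X" "f \<subseteq> X"
      using t[OF XF] by (auto simp: spans_D_def)
    have "finite X" using t[OF XF] by (metis card.infinite zero_neq_numeral)
    moreover have "card e = 3" "card f = 3" "finite e" "finite f"
      using G X by (auto simp: three_graph_def nsets_def)
    ultimately show ?thesis using X t[OF XF]
      by (intro exI[of _ "(X, {e, f})"]) (auto simp: D_copy_in_def is_D_def subhypergraph_def hverts_def
          hedges_def three_graph_def nsets_def)
  qed
  then obtain h where h: "\<And>X. X \<in> F \<Longrightarrow> D_copy_in (h X) G" "\<And>X. X \<in> F \<Longrightarrow> hverts (h X) = X" by metis
  have "inj_on h F" using h(2) by (metis inj_onI)
  then have "card (h ` F) = order_of G div 4" using F by (simp add: card_image)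
  moreover have "pairwise (\<lambda>H K. hverts H \<inter> hverts K = {}) (h ` F)"
    unfolding pairwise_image using F(3) h(2) by (auto simp: pairwise_def disjnt_def)
  ultimately show ?thesis unfolding D_tileable_def using F h by (intro exI[of _ "h ` F"]) auto
qed

text \<open>
  The pairs that form an edge with $s$ partition $S - \{s\}$, since the partner of each vertex is
  unique.
\<close>

lemma odd_card_if_unique_third_vertex:
  assumes fin: "finite S" and e3: "\<And>e. e \<in> E \<Longrightarrow> card e = 3" and s: "s \<in> S"
    and uniq: "\<And>t. t \<in> S \<Longrightarrow> s \<noteq> t \<Longrightarrow> card {u \<in> S. {s, t, u} \<in> E} = 1"
  shows "odd (card S)"
proof -
  define P where "P = {{t, u} | t u. t \<in> S \<and> u \<in> S \<and> {s, t, u} \<in> E}"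
  have dist: "s \<noteq> t \<and> s \<noteq> u \<and> t \<noteq> u" if "{s, t, u} \<in> E" for t u
    by (rule distinct_if_card_3[OF e3[OF that]])
  have "{t, u} = {t', u'}" if "{s, t, u} \<in> E" "{s, t', u'} \<in> E" "t \<in> S" "u \<in> S" "t' \<in> S" "u' \<in> S" "x \<in> {t, u}" "x \<in> {t', u'}" for t u t' u' x
  proof -
    have 1: "\<exists>y. {t, u} = {x, y} \<and> y \<in> S \<and> {s, x, y} \<in> E"
      using that by (auto simp: insert_commute)
    have 2: "\<exists>y. {t', u'} = {x, y} \<and> y \<in> S \<and> {s, x, y} \<in> E"
      using that by (auto simp: insert_commute)
    obtain y y' where y: "{t, u} = {x, y}" "{t', u'} = {x, y'}" "y \<in> S" "y' \<in> S" "{s, x, y} \<in> E" "{s, x, y'} \<in> E"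
      using 1 2 by blast
    have "x \<in> S" "s \<noteq> x" using that dist by auto
    then obtain z where "{u \<in> S. {s, x, u} \<in> E} = {z}" using uniq[of x] by (auto simp: card_1_singleton_iff)
    then have "y \<in> {z}" "y' \<in> {z}" using y by blast+
    then have "y = y'" by simp
    then show ?thesis using y by simp
  qed
  then have "pairwise disjnt P"
    unfolding P_def pairwise_def disjnt_def by blast
  moreover have "\<And>p. p \<in> P \<Longrightarrow> finite p \<and> card p = 2" using dist by (auto simp: P_def)
  ultimately have "card (\<Union>P) = 2 * card P" by (subst card_Union_disjoint) auto
  moreover have "\<Union>P = S - {s}"
  proof
    show "\<Union>P \<subseteq> S - {s}" using dist by (auto simp: P_def)
    show "S - {s} \<subseteq> \<Union>P"
    proof
      fix t assume t: "t \<in> S - {s}"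
      then obtain u where "{u \<in> S. {s, t, u} \<in> E} = {u}" using uniq[of t] by (auto simp: card_1_singleton_iff)
      then have "u \<in> S" "{s, t, u} \<in> E" by blast+
      then show "t \<in> \<Union>P" using t by (auto simp: P_def)
    qed
  qed
  ultimately have "card S = Suc (2 * card P)" using fin s by (metis card.remove)
  then show ?thesis by simp
qed

theorem theorem1p4:
  shows "\<exists>\<epsilon>\<^sub>0::real. \<epsilon>\<^sub>0 > 0 \<and> (\<exists>n\<^sub>0::nat. \<forall>n\<ge>n\<^sub>0. 4 dvd n \<longrightarrow>
    (\<forall>G :: 'a hypergraph.
       three_graph G \<longrightarrow>
       order_of G = n \<longrightarrow>
       min_codegree G \<ge> (if odd (n div 4) then n div 4 else n div 4 + 1) \<longrightarrow>
       extremal \<epsilon>\<^sub>0 G \<longrightarrow>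
       D_tileable G))"
proof (intro exI[of _ "1 / 60000 :: real"] conjI exI[of _ "80000 :: nat"] allI impI)
  fix n :: nat and G :: "'a hypergraph"
  assume n: "80000 \<le> n" "4 dvd n" and G: "three_graph G" and order: "order_of G = n"
    and codeg: "(if odd (n div 4) then n div 4 else n div 4 + 1) \<le> min_codegree G"
    and ext: "extremal (1 / 60000) G"
  \<comment> \<open>These constants give $|A| \<le> (1 + 1/20000)m$ with $m \<ge> 20000$, hence $k + 1 \<le> m/10000$.\<close>
  define m where "m = n div 4"
  have nm: "n = 4 * m" using n by (simp add: m_def)
  define V E where "V = hverts G" and "E = hedges G"
  have finV: "finite V" and cV: "card V = 4 * m" using G order nm by (auto simp: V_def three_graph_def order_of_def)
  have e3: "card e = 3" and eV: "e \<subseteq> V" if "e \<in> E" for e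
    using G that by (auto simp: three_graph_def nsets_def V_def E_def)
  have nb: "m \<le> card {w \<in> V. {u, v, w} \<in> E}" "even m \<Longrightarrow> m + 1 \<le> card {w \<in> V. {u, v, w} \<in> E}"
    if "u \<in> V" "v \<in> V" "u \<noteq> v" for u v
  proof -
    have "nbhd G u v = {w \<in> V. {u, v, w} \<in> E}" using eV by (auto simp: nbhd_def E_def)
    then have "min_codegree G \<le> card {w \<in> V. {u, v, w} \<in> E}"
      using min_codegree_le[OF G, of u v] that by (simp add: V_def)
    then show "m \<le> card {w \<in> V. {u, v, w} \<in> E}" "even m \<Longrightarrow> m + 1 \<le> card {w \<in> V. {u, v, w} \<in> E}"
      using codeg by (auto simp: m_def split: if_splits)
  qed
  define free where "free S \<longleftrightarrow> S \<subseteq> V \<and> \<not> (\<exists>X \<subseteq> S. card X = 4 \<and> spans_D E X)" for S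
  obtain S0 where S0: "free S0" "(1 - 1 / 60000) * (3 * real n / 4) \<le> card S0"
    using ext D_free_iff[OF G] order by (auto simp: extremal_def free_def V_def E_def)
  have "finite {S. free S}" using finV by (auto simp: free_def intro: finite_subset[of _ "Pow V"])
  then obtain S where S: "S0 \<subseteq> S" "free S" and max: "\<And>S'. free S' \<Longrightarrow> S \<subseteq> S' \<Longrightarrow> S = S'"
    using finite_has_maximal2[of "{S. free S}" S0] S0 by auto
  have SV: "S \<subseteq> V" using S by (simp add: free_def)
  have finS: "finite S" using SV finV finite_subset by blast
  define A where "A = V - S"
  have cAS: "card A + card S = 4 * m"
    using SV finS finV cV by (metis A_def card_Diff_subset card_mono le_add_diff_inverse2)
  have AS: "A \<union> S = V" "A \<inter> S = {}" "finite A" using SV finV by (auto simp: A_def)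
  have "real (card S0) \<le> card S" using S finS by (simp add: card_mono)
  then have "(1 - 1 / 60000) * (3 * real m) \<le> card S" using S0(2) nm by simp
  then have "(1 - 1 / 60000) * (3 * real m) + real (card A) \<le> 4 * real m" using cAS by linarith
  then have "20000 * real (card A) \<le> 20001 * real m" by simp
  then have cA_upper: "20000 * card A \<le> 20001 * m" by linarith
  have in_S: "card {u \<in> S. {s, t, u} \<in> E} \<le> 1" if st: "s \<in> S" "t \<in> S" for s t
  proof (rule ccontr)
    assume "\<not> ?thesis"
    then obtain u v where uv: "u \<in> S" "v \<in> S" "u \<noteq> v" "{s, t, u} \<in> E" "{s, t, v} \<in> E"
      using finS by (auto simp: card_le_Suc0_iff_eq)
    have d: "s \<noteq> t" "s \<noteq> u" "t \<noteq> u" "s \<noteq> v" "t \<noteq> v"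
      using distinct_if_card_3[OF e3[OF uv(4)]] distinct_if_card_3[OF e3[OF uv(5)]] by blast+
    then have "card {s, t, u, v} = 4" "u \<notin> {s, t, v}" using uv(3) by simp_all
    then have "{s, t, u} \<noteq> {s, t, v}" by blast
    then have "spans_D E {s, t, u, v}" by (intro spans_DI[OF uv(4,5)]) auto
    moreover have "{s, t, u, v} \<subseteq> S" using st uv by simp
    ultimately show False using S(2) \<open>card {s, t, u, v} = 4\<close> unfolding free_def by blast
  qed
  have split: "card {w \<in> V. {u, v, w} \<in> E} = card {a \<in> A. {u, v, a} \<in> E} + card {w \<in> S. {u, v, w} \<in> E}" for u v
  proof -
    have "{w \<in> V. {u, v, w} \<in> E} = {a \<in> A. {u, v, a} \<in> E} \<union> {w \<in> S. {u, v, w} \<in> E}" using AS by auto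
    then show ?thesis using AS finS by (simp only:) (rule card_Un_disjoint, auto)
  qed
  have leA: "card {a \<in> A. {u, v, a} \<in> E} \<le> card A" for u v using AS by (intro card_mono) auto
  have "2 \<le> card S" using cAS cA_upper n nm by linarith
  then obtain s0 t0 where st0: "s0 \<in> S" "t0 \<in> S" "s0 \<noteq> t0"
    by (metis card_2_iff' obtain_subset_with_card_n subsetD)
  \<comment> \<open>A Steiner triple system on $3m + 1$ points with $m$ odd would arise otherwise.\<close>
  have "m \<le> card A"
  proof (rule ccontr)
    assume less: "\<not> m \<le> card A"
    have "odd m"
    proof
      assume "even m"
      then have "m + 1 \<le> card A + 1"
        using nb(2)[of s0 t0] st0 SV split[of s0 t0] leA[of s0 t0] in_S[of s0 t0] by force
      then show False using less by simp
    qed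
    have "card {u \<in> S. {s0, t, u} \<in> E} = 1" if "t \<in> S" "s0 \<noteq> t" for t
      using nb(1)[of s0 t] that st0 SV split[of s0 t] leA[of s0 t] in_S[of s0 t] less by force
    then have "odd (card S)" using odd_card_if_unique_third_vertex[OF finS e3] st0 by blast
    moreover have "card A + 1 = m"
      using nb(1)[of s0 t0] st0 SV split[of s0 t0] leA[of s0 t0] in_S[of s0 t0] less by force
    then have "card S = 3 * m + 1" using cAS by linarith
    ultimately show False using \<open>odd m\<close> by simp
  qed
  define k where "k = card A - m"
  interpret near_extremal E A S m k
  proof
    show "finite A" "finite S" "A \<inter> S = {}" using AS finS by auto
    show "card A = m + k" "card S + k = 3 * m" using \<open>m \<le> card A\<close> cAS by (auto simp: k_def)
    show "10000 * (k + 1) \<le> m" using cA_upper n nm \<open>m \<le> card A\<close> by (simp add: k_def)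
    show "card e = 3" if "e \<in> E" for e using e3 that .
    show "m \<le> card {a \<in> A. {a, s, t} \<in> E} + 1" if "s \<in> S" "t \<in> S" "s \<noteq> t" for s t
    proof -
      have "{a \<in> A. {a, s, t} \<in> E} = {a \<in> A. {s, t, a} \<in> E}" by (auto simp: insert_commute)
      then show ?thesis using nb(1)[of s t] split[of s t] in_S[of s t] that SV by force
    qed
    show "m \<le> card {w \<in> A \<union> S. {a, s, w} \<in> E}" if "a \<in> A" "s \<in> S" for a s
      using nb(1)[of a s] that SV AS by (auto simp: A_def)
    show "\<exists>T\<subseteq>S. card T = 3 \<and> spans_D E (insert a T)" if a: "a \<in> A" for a
    proof -
      have "\<not> free (insert a S)" using max[of "insert a S"] a by (auto simp: A_def)
      then obtain X where X: "X \<subseteq> insert a S" "card X = 4" "spans_D E X"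
        using a SV by (auto simp: free_def A_def)
      have "a \<in> X" using X S(2) unfolding free_def by blast
      then have "card (X - {a}) = 3" "insert a (X - {a}) = X" using X by auto
      then show ?thesis using X by (intro exI[of _ "X - {a}"]) auto
    qed
  qed
  obtain F where "finite F" "card F = m" "pairwise disjnt F"
    "\<And>X. X \<in> F \<Longrightarrow> X \<subseteq> A \<union> S \<and> card X = 4 \<and> spans_D E X"
    using perfect_tiling by blast
  then show "D_tileable G"
    using AS order nm by (intro D_tileable_if_disjoint_tiles[OF G, of F]) (auto simp: V_def E_def)
qed simp

end
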